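(* Let $\gamma\ge 1$ and let $G$ be a bipartite graph without isolated vertices having exactly one minimum dominating set, where $\gamma = \gamma(G)$ is the domination number of $G$, and suppose $G$ has exactly $n = 3\gamma$ vertices. Then the number of edges of $G$ satisfies $$s(G) \leq 2\gamma + 2\Big\lceil\frac{\gamma}{2}\Big\rceil\Big\lfloor\frac{\gamma}{2}\Big\rfloor.$$
   Context: All graphs are finite and simple. A dominating set of a graph $G=(V,E)$ is a set $D\subseteq V$ such that every vertex of $V\setminus D$ is adjacent to some vertex of $D$; the domination number $\gamma(G)$ is the minimum size of a dominating set, and a minimum dominating set is a dominating set of size $\gamma(G)$. $s(G)$ denotes the number of edges of $G$. *)

theory Defs
  imports Complex_Main
begin

definition simple_graph :: "'a set \<Rightarrow> 'a set set \<Rightarrow> bool" where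
  "simple_graph V E \<longleftrightarrow> finite V \<and> (\<forall>e\<in>E. e \<subseteq> V \<and> card e = 2)"

definition bipartite :: "'a set \<Rightarrow> 'a set set \<Rightarrow> bool" where
  "bipartite V E \<longleftrightarrow>
     (\<exists>A B. A \<union> B = V \<and> A \<inter> B = {} \<and> (\<forall>e\<in>E. \<exists>a\<in>A. \<exists>b\<in>B. e = {a, b}))"

definition isolated :: "'a set \<Rightarrow> 'a set set \<Rightarrow> 'a \<Rightarrow> bool" where
  "isolated V E v \<longleftrightarrow> v \<in> V \<and> (\<forall>u\<in>V. {u, v} \<notin> E)"

definition dominating_set :: "'a set \<Rightarrow> 'a set set \<Rightarrow> 'a set \<Rightarrow> bool" where
  "dominating_set V E D \<longleftrightarrow> D \<subseteq> V \<and> (\<forall>v\<in>V - D. \<exists>u\<in>D. {u, v} \<in> E)"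

(* For finite V, Min is taken over a finite set which is nonempty, since V dominates itself. *)
definition domination_number :: "'a set \<Rightarrow> 'a set set \<Rightarrow> nat" where
  "domination_number V E = Min (card ` {D. dominating_set V E D})"

definition min_dominating_set :: "'a set \<Rightarrow> 'a set set \<Rightarrow> 'a set \<Rightarrow> bool" where
  "min_dominating_set V E D \<longleftrightarrow> dominating_set V E D \<and> card D = domination_number V E"

end

theory Submission
  imports Defs
begin

text \<open>
  Let \<open>D\<close> be the unique minimum dominating set. Uniqueness forces each \<open>x \<in> D\<close> to have at
  least two private neighbours outside \<open>D\<close>, for otherwise \<open>x\<close> could be exchanged for one of its
  neighbours. As \<open>card V = 3 * \<gamma>\<close>, every \<open>x \<in> D\<close> has exactly two, and they exhaust \<open>V - D\<close>;
  hence exactly \<open>2 * \<gamma>\<close> edges join \<open>D\<close> to \<open>V - D\<close>. Bipartiteness attaches each remaining edge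
  to a pair \<open>(x, y)\<close> of vertices of \<open>D\<close> on opposite sides: it is \<open>{x, y}\<close> or joins a private
  neighbour of \<open>x\<close> to one of \<open>y\<close>. Three such edges at one pair would allow \<open>x\<close> and \<open>y\<close> to be
  exchanged for two other vertices, so there are at most \<open>2 * p * (\<gamma> - p)\<close> of them, where \<open>p\<close>
  is the number of vertices of \<open>D\<close> on one side.
\<close>

section \<open>Private neighbours under a unique minimum dominating set\<close>

locale unique_min_dominating =
  fixes V :: "'a set" and E :: "'a set set" and D :: "'a set"
  assumes simple: "simple_graph V E"
    and no_isolated: "\<And>v. \<not> isolated V E v"
    and dominating: "dominating_set V E D"
    and unique: "\<And>D'. dominating_set V E D' \<Longrightarrow> card D' \<le> card D \<Longrightarrow> D' = D"
begin

text \<open>Only vertices outside \<open>D\<close> count, so \<open>x\<close> is never a private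
  neighbour of itself.\<close>

definition private_nbrs :: "'a \<Rightarrow> 'a set" where
  "private_nbrs x = {v \<in> V - D. \<forall>u\<in>D. {u, v} \<in> E \<longleftrightarrow> u = x}"

lemma finite_vertices [simp]: "finite V"
  using simple by (simp add: simple_graph_def)

lemma D_subset: "D \<subseteq> V"
  using dominating by (simp add: dominating_set_def)

lemma finite_D [simp]: "finite D"
  using D_subset finite_vertices finite_subset by blast

lemma finite_private_nbrs [simp]: "finite (private_nbrs x)"
  by (simp add: private_nbrs_def)

lemma edge_neq: "{u, v} \<in> E \<Longrightarrow> u \<noteq> v"
  using simple by (auto simp: simple_graph_def)

lemma private_nbrs_disjoint:
  "x \<in> D \<Longrightarrow> x \<noteq> y \<Longrightarrow> private_nbrs x \<inter> private_nbrs y = {}"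
  by (auto simp: private_nbrs_def)

lemma private_nbr_edge: "x \<in> D \<Longrightarrow> v \<in> private_nbrs x \<Longrightarrow> {x, v} \<in> E"
  by (auto simp: private_nbrs_def)

lemma two_private_nbrs:
  assumes x: "x \<in> D"
  shows "2 \<le> card (private_nbrs x)"
proof (rule ccontr)
  assume "\<not> 2 \<le> card (private_nbrs x)"
  then have "card (private_nbrs x) = 0 \<or> card (private_nbrs x) = 1"
    by linarith
  \<comment> \<open>The replacement \<open>u\<close> has to be adjacent to \<open>x\<close>, which
    loses its place in the set, and has to absorb the only vertex, if any, that \<open>x\<close>
    alone dominated.\<close>
  then obtain u where u: "u \<in> V" "{u, x} \<in> E" "private_nbrs x \<subseteq> {u}"
  proof
    assume "card (private_nbrs x) = 0"
    moreover obtain w where "w \<in> V" "{w, x} \<in> E"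
      using no_isolated[of x] x D_subset by (auto simp: isolated_def)
    ultimately show thesis
      using that by simp
  next
    assume "card (private_nbrs x) = 1"
    then obtain w where w: "private_nbrs x = {w}"
      by (auto simp: card_1_singleton_iff)
    then have "w \<in> V" "{w, x} \<in> E"
      using private_nbr_edge[OF x, of w] by (auto simp: private_nbrs_def insert_commute)
    then show thesis
      using that w by simp
  qed
  let ?D = "insert u (D - {x})"
  have "dominating_set V E ?D"
    unfolding dominating_set_def
  proof (intro conjI ballI)
    show "?D \<subseteq> V"
      using u D_subset by auto
    fix v assume v: "v \<in> V - ?D"
    show "\<exists>w\<in>?D. {w, v} \<in> E"
    proof (cases "v = x")
      case True
      then show ?thesis using u by auto
    next
      case False
      then have "v \<in> V - D" "v \<notin> private_nbrs x"
        using v u by auto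
      then show ?thesis
        using dominating unfolding dominating_set_def private_nbrs_def by blast
    qed
  qed
  \<comment> \<open>Equality may fail, since \<open>u\<close> may already lie in
    \<open>D\<close>.\<close>
  moreover have "card ?D \<le> card D"
    using card_insert_le_m1[of "card D" "D - {x}" u] x card_gt_0_iff[of D] by auto
  ultimately have "?D = D"
    by (rule unique)
  then show False
    using x edge_neq[OF u(2)] by auto
qed

end

section \<open>The extremal case: exchanging two vertices of \<open>D\<close>\<close>

locale unique_min_dominating_extremal = unique_min_dominating +
  assumes card_vertices: "card V = 3 * card D"
begin

text \<open>Disjoint sets with at least two elements each are packed into the
  \<open>2 * card D\<close> vertices of \<open>V - D\<close>, so equality holds throughout.\<close>

lemma private_nbrs_partition:
  shows "(\<Union>x\<in>D. private_nbrs x) = V - D"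
    and "\<And>x. x \<in> D \<Longrightarrow> card (private_nbrs x) = 2"
proof -
  let ?U = "\<Union>x\<in>D. private_nbrs x"
  have U: "?U \<subseteq> V - D"
    by (auto simp: private_nbrs_def)
  have cU: "card ?U = (\<Sum>x\<in>D. card (private_nbrs x))"
    using private_nbrs_disjoint by (intro card_UN_disjoint) auto
  have cV: "card (V - D) = 2 * card D"
    using card_vertices D_subset by (simp add: card_Diff_subset)
  have ge: "(\<Sum>x\<in>D. 2) \<le> (\<Sum>x\<in>D. card (private_nbrs x))"
    by (intro sum_mono two_private_nbrs)
  have le: "card ?U \<le> card (V - D)"
    using U by (intro card_mono) auto
  have "card ?U = card (V - D)"
    using ge le cU cV by simp
  then show "?U = V - D"
    using U by (intro card_subset_eq) auto
  show "card (private_nbrs x) = 2" if x: "x \<in> D" for x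
  proof (rule ccontr)
    assume "card (private_nbrs x) \<noteq> 2"
    then have "2 < card (private_nbrs x)"
      using two_private_nbrs[OF x] by simp
    then have "(\<Sum>x\<in>D. 2) < (\<Sum>x\<in>D. card (private_nbrs x))"
      using x two_private_nbrs by (intro sum_strict_mono_ex1) auto
    then show False
      using le cU cV by simp
  qed
qed

text \<open>Any other vertex outside \<open>D\<close> is a private neighbour of some
  \<open>z\<close> that survives the exchange. Hence domination needs checking only on
  \<open>x\<close>, \<open>y\<close> and their private neighbours.\<close>

lemma exchange_pair:
  assumes xy: "x \<in> D" "y \<in> D" "x \<noteq> y" and pq: "p \<in> V" "q \<in> V"
    and dom: "\<And>v. v \<in> {x, y} \<union> private_nbrs x \<union> private_nbrs y \<Longrightarrow> v \<noteq> p \<Longrightarrow> v \<noteq> q \<Longrightarrow>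
      {p, v} \<in> E \<or> {q, v} \<in> E"
  shows "{p, q} = {x, y}"
proof -
  let ?D = "{p, q} \<union> (D - {x, y})"
  have "dominating_set V E ?D"
    unfolding dominating_set_def
  proof (intro conjI ballI)
    show "?D \<subseteq> V"
      using pq D_subset by auto
    fix v assume v: "v \<in> V - ?D"
    show "\<exists>w\<in>?D. {w, v} \<in> E"
    proof (cases "v \<in> {x, y} \<union> private_nbrs x \<union> private_nbrs y")
      case True
      then show ?thesis using dom[of v] v by blast
    next
      case False
      then have "v \<in> V - D" using v by auto
      then obtain z where "z \<in> D" "v \<in> private_nbrs z"
        using private_nbrs_partition(1) by blast
      then show ?thesis
        using False private_nbr_edge[of z v] by blast
    qed
  qed
  moreover have "card ?D \<le> card D"
  proof -
    have "card ?D \<le> card {p, q} + card (D - {x, y})"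
      by (rule card_Un_le)
    also have "card (D - {x, y}) = card D - 2"
      using xy by (subst card_Diff_subset) auto
    also have "card {p, q} \<le> 2"
      by (simp add: card_insert_if)
    finally have "card ?D \<le> 2 + (card D - 2)"
      by simp
    moreover have "card {x, y} \<le> card D"
      using xy by (intro card_mono) auto
    ultimately show ?thesis
      using xy by simp
  qed
  ultimately have "?D = D"
    by (rule unique)
  then have "{x, y} \<subseteq> {p, q}"
    using xy by blast
  then show ?thesis
    using xy(3) by auto
qed

text \<open>Edges from \<open>x\<close> or \<open>y\<close> to private neighbours are left out;
  \<open>card_edges\<close> counts them separately.\<close>

definition pair_edges :: "'a \<Rightarrow> 'a \<Rightarrow> 'a set set" where
  "pair_edges x y = E \<inter> insert {x, y} {{p, q} | p q. p \<in> private_nbrs x \<and> q \<in> private_nbrs y}"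

text \<open>One end of each matching edge, taken on opposite sides, could replace \<open>x\<close>
  and \<open>y\<close>: \<open>a\<close> dominates \<open>x\<close> and \<open>c\<close>, while
  \<open>d\<close> dominates \<open>y\<close> and \<open>b\<close>.\<close>

lemma no_perfect_matching:
  assumes xy: "x \<in> D" "y \<in> D" "x \<noteq> y"
    and nx: "private_nbrs x = {a, b}" and ny: "private_nbrs y = {c, d}"
  shows "\<not> ({a, c} \<in> E \<and> {b, d} \<in> E)"
proof
  assume e: "{a, c} \<in> E \<and> {b, d} \<in> E"
  have m: "a \<in> private_nbrs x" "d \<in> private_nbrs y"
    using nx ny by auto
  then have V: "a \<in> V" "d \<in> V" "a \<notin> D"
    by (auto simp: private_nbrs_def)
  have "{a, d} = {x, y}"
  proof (rule exchange_pair[OF xy V(1,2)])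
    fix v assume "v \<in> {x, y} \<union> private_nbrs x \<union> private_nbrs y" "v \<noteq> a" "v \<noteq> d"
    then have "v = x \<or> v = y \<or> v = b \<or> v = c"
      using nx ny by auto
    then show "{a, v} \<in> E \<or> {d, v} \<in> E"
      using e private_nbr_edge[OF xy(1) m(1)] private_nbr_edge[OF xy(2) m(2)]
      by (auto simp: insert_commute)
  qed
  then show False
    using V(3) xy by auto
qed

text \<open>Otherwise \<open>a\<close> could replace \<open>y\<close>: the private neighbours of
  \<open>y\<close> are adjacent to \<open>a\<close>, and \<open>y\<close> itself is adjacent to
  \<open>x\<close>.\<close>

lemma no_cherry:
  assumes xy: "x \<in> D" "y \<in> D" "x \<noteq> y" "{x, y} \<in> E"
    and nx: "a \<in> private_nbrs x" and ny: "private_nbrs y = {c, d}"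
  shows "\<not> ({a, c} \<in> E \<and> {a, d} \<in> E)"
proof
  assume e: "{a, c} \<in> E \<and> {a, d} \<in> E"
  have V: "a \<in> V" "x \<in> V" "a \<notin> D"
    using nx D_subset xy by (auto simp: private_nbrs_def)
  have "{a, x} = {x, y}"
  proof (rule exchange_pair[OF xy(1-3) V(1,2)])
    fix v assume "v \<in> {x, y} \<union> private_nbrs x \<union> private_nbrs y" "v \<noteq> a" "v \<noteq> x"
    then consider "v = y" | "v \<in> private_nbrs x" | "v = c \<or> v = d"
      using ny by auto
    then show "{a, v} \<in> E \<or> {x, v} \<in> E"
      using e xy private_nbr_edge[of x v] by cases auto
  qed
  then show False
    using V(3) xy by auto
qed

text \<open>The four possible edges between the private neighbours form a 4-cycle, in which opposite
  edges exclude each other. If \<open>{x, y}\<close> is an edge, adjacent ones do too, leaving at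
  most one besides \<open>{x, y}\<close>; if not, each of the two perfect matchings contributes at
  most one.\<close>

lemma card_pair_edges:
  assumes xy: "x \<in> D" "y \<in> D" "x \<noteq> y"
  shows "card (pair_edges x y) \<le> 2"
proof -
  obtain a b where nx: "private_nbrs x = {a, b}"
    using private_nbrs_partition(2)[OF xy(1)] by (auto simp: card_2_iff)
  obtain c d where ny: "private_nbrs y = {c, d}"
    using private_nbrs_partition(2)[OF xy(2)] by (auto simp: card_2_iff)
  have eq: "pair_edges x y = E \<inter> {{x, y}, {a, c}, {a, d}, {b, c}, {b, d}}"
    unfolding pair_edges_def nx ny by auto
  have ny': "private_nbrs y = {d, c}" using ny by auto
  have match: "\<not> ({a, c} \<in> E \<and> {b, d} \<in> E)" "\<not> ({a, d} \<in> E \<and> {b, c} \<in> E)"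
    using no_perfect_matching[OF xy nx ny] no_perfect_matching[OF xy nx ny'] by auto
  have cherry: "\<not> ({a, c} \<in> E \<and> {a, d} \<in> E)" "\<not> ({b, c} \<in> E \<and> {b, d} \<in> E)"
      "\<not> ({a, c} \<in> E \<and> {b, c} \<in> E)" "\<not> ({a, d} \<in> E \<and> {b, d} \<in> E)"
    if "{x, y} \<in> E"
  proof -
    have yx: "{y, x} \<in> E" using that by (simp add: insert_commute)
    show "\<not> ({a, c} \<in> E \<and> {a, d} \<in> E)" "\<not> ({b, c} \<in> E \<and> {b, d} \<in> E)"
      using no_cherry[OF xy that _ ny] nx by blast+
    show "\<not> ({a, c} \<in> E \<and> {b, c} \<in> E)" "\<not> ({a, d} \<in> E \<and> {b, d} \<in> E)"
      using no_cherry[OF xy(2,1) xy(3)[symmetric] yx _ nx, of c]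
        no_cherry[OF xy(2,1) xy(3)[symmetric] yx _ nx, of d] ny
      by (simp_all add: insert_commute)
  qed
  have "\<exists>e f. pair_edges x y \<subseteq> {e, f}"
  proof (cases "{x, y} \<in> E")
    case True
    then have "\<exists>f. E \<inter> {{a, c}, {a, d}, {b, c}, {b, d}} \<subseteq> {f}"
      using match cherry by (auto simp: Int_insert_right)
    then obtain f where "E \<inter> {{a, c}, {a, d}, {b, c}, {b, d}} \<subseteq> {f}" ..
    then have "pair_edges x y \<subseteq> {{x, y}, f}"
      unfolding eq by blast
    then show ?thesis by blast
  next
    case False
    obtain e where e: "E \<inter> {{a, c}, {b, d}} \<subseteq> {e}"
      using match(1) by blast
    obtain f where f: "E \<inter> {{a, d}, {b, c}} \<subseteq> {f}"
      using match(2) by blast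
    have "pair_edges x y \<subseteq> {e, f}"
      unfolding eq using False e f by blast
    then show ?thesis by blast
  qed
  then obtain e f where ef: "pair_edges x y \<subseteq> {e, f}"
    by blast
  have "card (pair_edges x y) \<le> card {e, f}"
    using ef by (intro card_mono) auto
  also have "\<dots> \<le> 2"
    by (simp add: card_insert_if)
  finally show ?thesis .
qed

section \<open>Counting the edges\<close>

lemma card_edges:
  assumes AB: "A \<union> B = V" "A \<inter> B = {}" "\<forall>e\<in>E. \<exists>a\<in>A. \<exists>b\<in>B. e = {a, b}"
  shows "card E \<le> 2 * card D + 2 * (card (D \<inter> A) * card (D \<inter> B))"
proof -
  let ?S = "\<Union>x\<in>D. (\<lambda>v. {x, v}) ` private_nbrs x"
  let ?P = "(D \<inter> A) \<times> (D \<inter> B)"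
  let ?F = "\<Union>(x, y)\<in>?P. pair_edges x y"
  have sides: "(u \<in> A \<longrightarrow> v \<in> B) \<and> (u \<in> B \<longrightarrow> v \<in> A)" if "{u, v} \<in> E" for u v
    using AB that by (fastforce simp: doubleton_eq_iff)
  have cover: "E \<subseteq> ?S \<union> ?F"
  proof
    fix e assume e: "e \<in> E"
    then obtain u v where uv: "u \<in> A" "v \<in> B" "e = {u, v}"
      using AB by blast
    then have V: "u \<in> V" "v \<in> V" using AB by auto
    \<comment> \<open>Edges with exactly one end in \<open>D\<close> go to \<open>?S\<close>, all
      others to \<open>?F\<close>.\<close>
    consider "u \<in> D" "v \<in> D" | "u \<in> D" "v \<notin> D" | "u \<notin> D" "v \<in> D" | "u \<notin> D" "v \<notin> D"
      by blast
    then show "e \<in> ?S \<union> ?F"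
    proof cases
      case 1
      then have "e \<in> pair_edges u v"
        using e uv by (simp add: pair_edges_def)
      then show ?thesis using 1 uv by blast
    next
      case 2
      then obtain z where "z \<in> D" "v \<in> private_nbrs z"
        using V private_nbrs_partition(1) by blast
      moreover from this have "u = z"
        using 2 e uv by (auto simp: private_nbrs_def)
      ultimately show ?thesis using uv by blast
    next
      case 3
      then obtain z where "z \<in> D" "u \<in> private_nbrs z"
        using V private_nbrs_partition(1) by blast
      moreover have vu: "e = {v, u}"
        using uv by (simp add: insert_commute)
      moreover have "v = z"
        using 3 e vu calculation(2) by (auto simp: private_nbrs_def)
      ultimately show ?thesis by blast
    next
      case 4
      obtain z where z: "z \<in> D" "u \<in> private_nbrs z"
        using 4 V private_nbrs_partition(1) by blast
      obtain w where w: "w \<in> D" "v \<in> private_nbrs w"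
        using 4 V private_nbrs_partition(1) by blast
      \<comment> \<open>A private neighbour lies on the side opposite to its vertex of
        \<open>D\<close>, so the order of the pair is reversed: \<open>w\<close> comes
        first.\<close>
      have "z \<in> B" "w \<in> A"
        using sides[OF private_nbr_edge[OF z]] sides[OF private_nbr_edge[OF w]]
          uv z(1) w(1) D_subset AB by blast+
      moreover have "e \<in> pair_edges w z"
        using e uv(3) z w insert_commute[of u v "{}"] unfolding pair_edges_def by blast
      ultimately show ?thesis using z w by blast
    qed
  qed
  have E: "finite E"
    using simple by (intro finite_subset[of E "Pow V"]) (auto simp: simple_graph_def)
  have finF: "finite (pair_edges x y)" for x y
    using E by (simp add: pair_edges_def)
  have "card E \<le> card (?S \<union> ?F)"
    using cover finF by (intro card_mono) auto
  also have "\<dots> \<le> card ?S + card ?F"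
    by (rule card_Un_le)
  also have "card ?S \<le> (\<Sum>x\<in>D. card ((\<lambda>v. {x, v}) ` private_nbrs x))"
    by (intro card_UN_le) simp
  also have "\<dots> \<le> (\<Sum>x\<in>D. card (private_nbrs x))"
    by (intro sum_mono card_image_le finite_private_nbrs)
  also have "\<dots> = 2 * card D"
    using private_nbrs_partition(2) by simp
  also have "card ?F \<le> (\<Sum>(x, y)\<in>?P. card (pair_edges x y))"
    by (rule order_trans[OF card_UN_le]) (auto simp: split_def)
  also have "\<dots> \<le> (\<Sum>_\<in>?P. 2)"
    using AB(2) by (intro sum_mono) (auto intro!: card_pair_edges)
  also have "\<dots> = 2 * (card (D \<inter> A) * card (D \<inter> B))"
    by (simp add: card_cartesian_product)
  finally show ?thesis by simp
qed

end

section \<open>The balanced split maximises the product\<close>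

lemma mult_le_ceiling_floor_half:
  fixes p q :: nat
  shows "int (p * q) \<le> \<lceil>real (p + q) / 2\<rceil> * \<lfloor>real (p + q) / 2\<rfloor>"
proof -
  define r where "r = real (p + q) / 2"
  define f where "f = \<lfloor>r\<rfloor>"
  define c where "c = \<lceil>r\<rceil>"
  have r: "real_of_int (int (p + q)) = 2 * r"
    by (simp add: r_def)
  \<comment> \<open>The bounds on floor and ceiling are pulled back to the integers, where they
    force \<open>c + f = p + q\<close> without a split on parity.\<close>
  have "real_of_int (2 * f) \<le> real_of_int (int (p + q))"
    "real_of_int (int (p + q)) < real_of_int (2 * f + 2)"
    unfolding r using floor_correct[of r, folded f_def] by simp_all
  then have f: "2 * f \<le> int (p + q)" "int (p + q) < 2 * f + 2"
    by (simp_all only: of_int_le_iff of_int_less_iff)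
  have "real_of_int (int (p + q)) \<le> real_of_int (2 * c)"
    "real_of_int (2 * c) < real_of_int (int (p + q) + 2)"
    unfolding of_int_add r using ceiling_correct[of r, folded c_def] by simp_all
  then have "int (p + q) \<le> 2 * c" "2 * c < int (p + q) + 2"
    by (simp_all only: of_int_le_iff of_int_less_iff)
  with f have c: "c = int (p + q) - f"
    by presburger
  \<comment> \<open>\<open>c * f - p * q = (p - f) * (p - c)\<close>, and no integer lies strictly between \<open>f\<close> and \<open>c\<close>.\<close>
  have "0 \<le> (int p - f) * (int p - c)"
  proof (cases "int p \<le> f")
    case True
    then have "int p \<le> c" using c f by linarith
    with True show ?thesis by (simp add: mult_nonpos_nonpos)
  next
    case False
    then have "c \<le> int p" using c f by linarith
    with False show ?thesis by simp
  qed
  also have "\<dots> = c * f - int p * (c + f - int p)"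
    by (simp add: algebra_simps)
  also have "c + f - int p = int q"
    using c by simp
  finally show ?thesis
    unfolding f_def c_def r_def by simp
qed

theorem theorem2p11:
  fixes V :: "'a set" and E :: "'a set set" and \<gamma> :: nat
  assumes "simple_graph V E"
    and "bipartite V E"
    and "\<not> (\<exists>v. isolated V E v)"
    and "\<exists>!D. min_dominating_set V E D"
    and "\<gamma> = domination_number V E"
    and "\<gamma> \<ge> 1"
    and "card V = 3 * \<gamma>"
  shows "int (card E) \<le> 2 * int \<gamma> + 2 * \<lceil>real \<gamma> / 2\<rceil> * \<lfloor>real \<gamma> / 2\<rfloor>"
proof -
  obtain D where D: "min_dominating_set V E D"
    and unique: "\<And>D'. min_dominating_set V E D' \<Longrightarrow> D' = D"
    using assms(4) by blast
  have dom: "dominating_set V E D" and card_D: "card D = \<gamma>"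
    using D assms(5) by (auto simp: min_dominating_set_def)
  have fin: "finite V"
    using assms(1) by (simp add: simple_graph_def)
  have fin_dom: "finite {D. dominating_set V E D}"
    using fin by (auto simp: dominating_set_def intro: finite_subset[of _ "Pow V"])
  \<comment> \<open>Since no dominating set is smaller than \<open>D\<close>, such a
    \<open>D'\<close> is itself minimum, and uniqueness applies.\<close>
  have eq_D: "D' = D" if "dominating_set V E D'" "card D' \<le> card D" for D'
  proof -
    have "domination_number V E \<le> card D'"
      unfolding domination_number_def using fin_dom that(1) by (intro Min_le) auto
    then show ?thesis
      using that card_D assms(5) by (intro unique) (simp add: min_dominating_set_def)
  qed
  interpret unique_min_dominating_extremal V E D
  proof
    show "simple_graph V E" by (rule assms(1))
    show "\<not> isolated V E v" for v using assms(3) by blast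
    show "dominating_set V E D" by (rule dom)
    show "D' = D" if "dominating_set V E D'" "card D' \<le> card D" for D'
      using that by (rule eq_D)
    show "card V = 3 * card D" using assms(7) card_D by simp
  qed
  obtain A B where AB: "A \<union> B = V" "A \<inter> B = {}" "\<forall>e\<in>E. \<exists>a\<in>A. \<exists>b\<in>B. e = {a, b}"
    using assms(2) by (auto simp: bipartite_def)
  have "card (D \<inter> A) + card (D \<inter> B) = card ((D \<inter> A) \<union> (D \<inter> B))"
    using AB(2) by (intro card_Un_disjoint[symmetric]) auto
  also have "(D \<inter> A) \<union> (D \<inter> B) = D"
    using D_subset AB(1) by blast
  finally have "card (D \<inter> A) + card (D \<inter> B) = \<gamma>"
    using card_D by simp
  then show ?thesis
    using card_edges[OF AB] mult_le_ceiling_floor_half[of "card (D \<inter> A)" "card (D \<inter> B)"] card_D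
    by (simp add: mult.assoc flip: of_nat_mult of_nat_add)
qed

end
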